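(* Let $(X_n)_{n=1}^\infty$ be a sequence of topological spaces such that the product $P=\prod_{n=1}^\infty X_n$ is a pseudocompact space, and let $(Y,d_Y)$ be a path-connected separable metric R-space. Then every Baire one function $f:P\to Y$ is the pointwise limit on $P$ of a sequence of functions from ${\rm CF}(P,Y)$.
   Context: A map $f:X\to Y$ between topological spaces is a Baire one function (belongs to the first Baire class) if it is the pointwise limit of a sequence of continuous maps $X\to Y$. For the product $P=\prod_{n=1}^\infty X_n$, a map $f:P\to Y$ is finitely determined (depends on finitely many coordinates) if there is $n\in\mathbb N$ such that $f(x)=f(y)$ for all $x,y\in P$ with $x_i=y_i$ for $i=1,\dots,n$. ${\rm CF}(P,Y)$ denotes the set of all continuous finitely determined maps $P\to Y$. A metric space $(Y,d)$ is an R-space if for every $\varepsilon>0$ there exists a continuous map $r_\varepsilon:Y\times Y\to Y$ such that for all $y,z\in Y$: if $d(y,z)\le\varepsilon$ then $r_\varepsilon(y,z)=y$; and $d(r_\varepsilon(y,z),z)\le\varepsilon$. *)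

theory Defs
  imports "HOL-Analysis.Analysis"
begin

text \<open>No separation axioms are part of pseudocompactness here.\<close>

definition pseudocompact_space :: "'a topology \<Rightarrow> bool" where
  "pseudocompact_space X \<longleftrightarrow>
     (\<forall>f. continuous_map X euclideanreal f \<longrightarrow> bounded (f ` topspace X))"

definition baire_one_map :: "'a topology \<Rightarrow> 'b topology \<Rightarrow> ('a \<Rightarrow> 'b) \<Rightarrow> bool" where
  "baire_one_map X Y f \<longleftrightarrow>
     (\<exists>g. (\<forall>n::nat. continuous_map X Y (g n)) \<and>
          (\<forall>x\<in>topspace X. limitin Y (\<lambda>n. g n x) (f x) sequentially))"

text \<open>Sequences are indexed from 0, so the first \<open>n\<close> coordinates are those with index
  \<open>i < n\<close>. The factors are topologies on subsets of one common type; their carriers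
  \<open>topspace (X i)\<close> may be different sets.\<close>

abbreviation seq_product :: "(nat \<Rightarrow> 'a topology) \<Rightarrow> (nat \<Rightarrow> 'a) topology" where
  "seq_product X \<equiv> product_topology X UNIV"

definition finitely_determined :: "(nat \<Rightarrow> 'a topology) \<Rightarrow> ((nat \<Rightarrow> 'a) \<Rightarrow> 'b) \<Rightarrow> bool" where
  "finitely_determined X f \<longleftrightarrow>
     (\<exists>n. \<forall>x \<in> topspace (seq_product X). \<forall>y \<in> topspace (seq_product X).
        (\<forall>i<n. x i = y i) \<longrightarrow> f x = f y)"

definition CF :: "(nat \<Rightarrow> 'a topology) \<Rightarrow> 'b topology \<Rightarrow> ((nat \<Rightarrow> 'a) \<Rightarrow> 'b) set" where
  "CF X Y = {f. continuous_map (seq_product X) Y f \<and> finitely_determined X f}"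

definition R_space :: "'b set \<Rightarrow> ('b \<Rightarrow> 'b \<Rightarrow> real) \<Rightarrow> bool" where
  "R_space Y d \<longleftrightarrow> Metric_space Y d \<and>
     (\<forall>\<epsilon>>0. \<exists>r. continuous_map
          (prod_topology (Metric_space.mtopology Y d) (Metric_space.mtopology Y d))
          (Metric_space.mtopology Y d) r \<and>
        (\<forall>y\<in>Y. \<forall>z\<in>Y. (d y z \<le> \<epsilon> \<longrightarrow> r (y, z) = y) \<and> d (r (y, z)) z \<le> \<epsilon>))"

end

theory Submission
  imports Defs
begin

text \<open>On a pseudocompact product \<open>P\<close>, every continuous map \<open>h\<close> into a metric space is
  uniformly finitely determined: if points \<open>y\<^sub>k, z\<^sub>k\<close> agreeing in their first \<open>k\<close> coordinates
  satisfied \<open>d (h y\<^sub>k) (h z\<^sub>k) \<ge> \<epsilon>\<close> for all \<open>k\<close>, let \<open>\<phi>\<^sub>k x\<close> be the excess over \<open>\<epsilon> / 2\<close> of the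
  distance between the values of \<open>h\<close> at the two points obtained from \<open>x\<close> by replacing its tail
  from \<open>k\<close> on by the tails of \<open>y\<^sub>k\<close> and \<open>z\<^sub>k\<close>. As \<open>h\<close> oscillates little on a basic
  open box, which restricts only finitely many coordinates, the \<open>\<phi>\<^sub>k\<close> form a locally finite
  family, and the sum of all \<open>k \<phi>\<^sub>k\<close> is continuous and unbounded. Hence freezing the tail of the
  argument at a base point approximates a continuous \<open>h\<close> uniformly by maps from \<open>CF\<close>, and it
  suffices to approximate the \<open>n\<close>-th term of a sequence converging to \<open>f\<close> up to \<open>1 / (n + 1)\<close>.\<close>

lemma pseudocompact_locally_finite_small:
  fixes \<phi> :: "nat \<Rightarrow> 'a \<Rightarrow> real"
  assumes pc: "pseudocompact_space X"
    and cont: "\<And>k. continuous_map X euclideanreal (\<phi> k)"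
    and nonneg: "\<And>k x. x \<in> topspace X \<Longrightarrow> \<phi> k x \<ge> 0"
    and locfin: "\<And>x. x \<in> topspace X \<Longrightarrow>
          \<exists>U K. openin X U \<and> x \<in> U \<and> (\<forall>k\<ge>K. \<forall>u\<in>U. \<phi> k u = 0)"
    and "\<delta> > 0"
  shows "\<exists>k. \<forall>x\<in>topspace X. \<phi> k x < \<delta>"
proof -
  obtain U K where U: "\<And>x. x \<in> topspace X \<Longrightarrow> openin X (U x) \<and> x \<in> U x"
    and K: "\<And>x k u. x \<in> topspace X \<Longrightarrow> k \<ge> K x \<Longrightarrow> u \<in> U x \<Longrightarrow> \<phi> k u = 0"
    using locfin by metis
  \<comment> \<open>The weight \<open>k\<close> turns boundedness into smallness: a bound
    \<open>B\<close> on \<open>\<Phi>\<close> gives \<open>real k * \<phi> k x \<le> B\<close>, so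
    any \<open>k\<close> with \<open>B < real k * \<delta>\<close> forces
    \<open>\<phi> k x < \<delta>\<close> for all \<open>x\<close> at once.\<close>
  define \<Phi> where "\<Phi> x = (\<Sum>k. real k * \<phi> k x)" for x
  have \<Phi>_eq: "\<Phi> u = (\<Sum>k<K x. real k * \<phi> k u)" if "x \<in> topspace X" "u \<in> U x" for x u
    unfolding \<Phi>_def by (rule suminf_finite) (use K that in auto)
  \<comment> \<open>On each open set \<open>U x\<close> the series is a finite sum of continuous
    functions; these local sums agree on overlaps and are glued.\<close>
  have "continuous_map X euclideanreal \<Phi>"
  proof (rule pasting_lemma[where I = "topspace X" and T = U
        and f = "\<lambda>x u. \<Sum>k<K x. real k * \<phi> k u"])
    show "continuous_map (subtopology X (U x)) euclideanreal (\<lambda>u. \<Sum>k<K x. real k * \<phi> k u)"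
      for x
      by (intro continuous_map_sum continuous_map_real_mult_left continuous_map_from_subtopology
          cont) auto
    show "(\<Sum>k<K x. real k * \<phi> k u) = (\<Sum>k<K y. real k * \<phi> k u)"
      if "x \<in> topspace X" "y \<in> topspace X" "u \<in> topspace X \<inter> U x \<inter> U y" for x y u
      using \<Phi>_eq[of x u] \<Phi>_eq[of y u] that by simp
    show "\<exists>x. x \<in> topspace X \<and> u \<in> U x \<and> \<Phi> u = (\<Sum>k<K x. real k * \<phi> k u)"
      if "u \<in> topspace X" for u
      using U[OF that] \<Phi>_eq[OF that] that by blast
  qed (simp add: U)
  then obtain B where B: "\<And>x. x \<in> topspace X \<Longrightarrow> \<bar>\<Phi> x\<bar> \<le> B"
    using pc unfolding pseudocompact_space_def bounded_iff by fastforce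
  obtain k :: nat where k: "B < real k * \<delta>"
    using reals_Archimedean3[OF \<open>\<delta> > 0\<close>] by blast
  have "\<phi> k x < \<delta>" if x: "x \<in> topspace X" for x
  proof (rule ccontr)
    assume "\<not> \<phi> k x < \<delta>"
    have "real k * \<phi> k x \<le> \<Phi> x"
    proof (cases "k < K x")
      case True
      then show ?thesis
        using \<Phi>_eq[OF x, of x] U[OF x] nonneg[OF x]
          member_le_sum[of k "{..<K x}" "\<lambda>k. real k * \<phi> k x"] by simp
    next
      case False
      then show ?thesis
        using \<Phi>_eq[OF x, of x] K[OF x, of k x] U[OF x] nonneg[OF x] by (simp add: sum_nonneg)
    qed
    moreover have "real k * \<delta> \<le> real k * \<phi> k x"
      using \<open>\<not> \<phi> k x < \<delta>\<close> by (intro mult_left_mono) auto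
    ultimately show False
      using B[OF x] k by linarith
  qed
  then show ?thesis by blast
qed

text \<open>The tail \<open>t\<close> comes before \<open>x\<close> so that
  \<open>splice k t\<close> is itself a self-map of the product, the one that freezes all
  coordinates from \<open>k\<close> on.\<close>

definition splice :: "nat \<Rightarrow> (nat \<Rightarrow> 'a) \<Rightarrow> (nat \<Rightarrow> 'a) \<Rightarrow> nat \<Rightarrow> 'a" where
  "splice k t x i = (if i < k then x i else t i)"

lemma continuous_map_splice:
  assumes "t \<in> topspace (seq_product X)"
  shows "continuous_map (seq_product X) (seq_product X) (splice k t)"
proof -
  have "continuous_map (seq_product X) (X i) (\<lambda>x. splice k t x i)" for i
    using assms by (cases "i < k") (auto simp: splice_def continuous_map_product_projection)
  then show ?thesis
    by (simp add: continuous_map_componentwise_UNIV)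
qed

lemma splice_topspace:
  assumes "t \<in> topspace (seq_product X)" "x \<in> topspace (seq_product X)"
  shows "splice k t x \<in> topspace (seq_product X)"
  using assms by (auto simp: splice_def PiE_iff)

text \<open>A basic box around \<open>x\<close> inside the preimage of \<open>V\<close> restricts no
  coordinate from some \<open>K\<close> on, so changing the tail from \<open>k \<ge> K\<close> on
  never leaves it. \<open>K\<close> is chosen before \<open>t\<close>, hence serves tails that vary
  with \<open>k\<close>.\<close>

lemma continuous_map_box:
  assumes h: "continuous_map (seq_product X) Y h" and V: "openin Y V"
    and x: "x \<in> topspace (seq_product X)" "h x \<in> V"
  shows "\<exists>U K. openin (seq_product X) U \<and> x \<in> U \<and>
           (\<forall>k\<ge>K. \<forall>t\<in>topspace (seq_product X). \<forall>u\<in>U. h (splice k t u) \<in> V)"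
proof -
  have "openin (seq_product X) {u \<in> topspace (seq_product X). h u \<in> V}"
    using openin_continuous_map_preimage[OF h V] .
  then have "\<exists>W. finite {i \<in> UNIV. W i \<noteq> topspace (X i)} \<and> (\<forall>i\<in>UNIV. openin (X i) (W i)) \<and>
      x \<in> Pi\<^sub>E UNIV W \<and> Pi\<^sub>E UNIV W \<subseteq> {u \<in> topspace (seq_product X). h u \<in> V}"
    using x unfolding openin_product_topology_alt by blast
  then obtain W where W: "finite {i. W i \<noteq> topspace (X i)}" "\<And>i. openin (X i) (W i)"
    "x \<in> Pi\<^sub>E UNIV W" "Pi\<^sub>E UNIV W \<subseteq> {u \<in> topspace (seq_product X). h u \<in> V}"
    by auto
  obtain K where K: "\<And>i. i \<ge> K \<Longrightarrow> W i = topspace (X i)"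
    using W(1) unfolding finite_nat_set_iff_bounded by (auto simp: not_le[symmetric])
  show ?thesis
  proof (intro exI conjI allI impI ballI)
    show "openin (seq_product X) (Pi\<^sub>E UNIV W)"
      using W by (simp add: openin_PiE_gen)
    show "h (splice k t u) \<in> V"
      if "k \<ge> K" "t \<in> topspace (seq_product X)" "u \<in> Pi\<^sub>E UNIV W" for k t u
    proof -
      have "splice k t u \<in> Pi\<^sub>E UNIV W"
        using that K by (auto simp: splice_def PiE_iff)
      with W(4) show ?thesis by blast
    qed
  qed fact
qed

context Metric_space
begin

lemma continuous_map_dist:
  assumes "continuous_map X mtopology f" "continuous_map X mtopology g"
  shows "continuous_map X euclideanreal (\<lambda>x. d (f x) (g x))"
  using continuous_map_mdist[of X "metric (M, d)" f g] assms
  by simp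

lemma pseudocompact_uniformly_finitely_determined:
  assumes pc: "pseudocompact_space (seq_product X)"
    and h: "continuous_map (seq_product X) mtopology h" and "\<epsilon> > 0"
  shows "\<exists>k. \<forall>y\<in>topspace (seq_product X). \<forall>z\<in>topspace (seq_product X).
           (\<forall>i<k. y i = z i) \<longrightarrow> d (h y) (h z) < \<epsilon>"
proof (rule ccontr)
  assume "\<not> ?thesis"
  then have "\<forall>k. \<exists>y\<in>topspace (seq_product X). \<exists>z\<in>topspace (seq_product X).
     (\<forall>i<k. y i = z i) \<and> \<not> d (h y) (h z) < \<epsilon>"
    by blast
  then obtain y z where y: "\<And>k. y k \<in> topspace (seq_product X)"
    and z: "\<And>k. z k \<in> topspace (seq_product X)"
    and yz: "\<And>k i. i < k \<Longrightarrow> y k i = z k i" "\<And>k. d (h (y k)) (h (z k)) \<ge> \<epsilon>"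
    by (metis linorder_not_less)
  \<comment> \<open>The threshold \<open>\<epsilon> / 2\<close> lies between two cases: near any
    point both values of \<open>h\<close> end up in one ball of radius
    \<open>\<epsilon> / 4\<close>, so \<open>\<phi> k\<close> vanishes for large \<open>k\<close>,
    while at \<open>y k\<close> the excess is still at least \<open>\<epsilon> / 2\<close>.\<close>
  define \<phi> where
    "\<phi> k x = max 0 (d (h (splice k (y k) x)) (h (splice k (z k) x)) - \<epsilon> / 2)" for k x
  have hM: "h u \<in> M" if "u \<in> topspace (seq_product X)" for u
    using continuous_map_image_subset_topspace[OF h] that by auto
  have "\<exists>k. \<forall>x\<in>topspace (seq_product X). \<phi> k x < \<epsilon> / 2"
  proof (rule pseudocompact_locally_finite_small[OF pc])
    show "continuous_map (seq_product X) euclideanreal (\<phi> k)" for k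
      unfolding \<phi>_def
      by (intro continuous_map_real_max continuous_map_diff continuous_map_dist
          continuous_map_compose[OF continuous_map_splice h, unfolded o_def] y z) auto
    show "\<exists>U K. openin (seq_product X) U \<and> x \<in> U \<and> (\<forall>k\<ge>K. \<forall>u\<in>U. \<phi> k u = 0)"
      if x: "x \<in> topspace (seq_product X)" for x
    proof -
      obtain U K where U: "openin (seq_product X) U" "x \<in> U"
        and K: "\<And>k t u. k \<ge> K \<Longrightarrow> t \<in> topspace (seq_product X) \<Longrightarrow> u \<in> U \<Longrightarrow>
                  h (splice k t u) \<in> mball (h x) (\<epsilon> / 4)"
        using continuous_map_box[OF h openin_mball x, of "h x" "\<epsilon> / 4"]
          centre_in_mball_iff[of "h x" "\<epsilon> / 4"] hM[OF x] \<open>\<epsilon> > 0\<close>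
        by (metis divide_pos_pos zero_less_numeral)
      have "\<phi> k u = 0" if "k \<ge> K" "u \<in> U" for k u
      proof -
        let ?p = "h (splice k (y k) u)" and ?q = "h (splice k (z k) u)"
        have p: "?p \<in> mball (h x) (\<epsilon> / 4)" and q: "?q \<in> mball (h x) (\<epsilon> / 4)"
          using K that y z by blast+
        then have "d ?p ?q \<le> d ?p (h x) + d (h x) ?q"
          using triangle by auto
        then have "d ?p ?q \<le> \<epsilon> / 2"
          using p q by (auto simp: commute)
        then show ?thesis
          by (simp add: \<phi>_def)
      qed
      with U show ?thesis by blast
    qed
  qed (use \<open>\<epsilon> > 0\<close> in \<open>auto simp: \<phi>_def\<close>)
  then obtain k where k: "\<phi> k (y k) < \<epsilon> / 2"
    using y by blast
  \<comment> \<open>As \<open>y k\<close> and \<open>z k\<close> agree below \<open>k\<close>,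
    putting the tail of \<open>z k\<close> on \<open>y k\<close> yields \<open>z k\<close>. Thus the
    distance in \<open>\<phi> k (y k)\<close> is that between \<open>h (y k)\<close> and
    \<open>h (z k)\<close>.\<close>
  have "splice k (y k) (y k) = y k" "splice k (z k) (y k) = z k"
    using yz by (auto simp: splice_def)
  with k yz(2)[of k] show False
    by (simp add: \<phi>_def max_def split: if_splits)
qed

lemma pseudocompact_CF_uniform_approx:
  assumes pc: "pseudocompact_space (seq_product X)"
    and h: "continuous_map (seq_product X) mtopology h" and "\<epsilon> > 0"
  shows "\<exists>g\<in>CF X mtopology. \<forall>x\<in>topspace (seq_product X). d (g x) (h x) < \<epsilon>"
proof (cases "topspace (seq_product X) = {}")
  \<comment> \<open>With no base point at which to freeze the tail, \<open>h\<close> itself serves,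
    being vacuously finitely determined.\<close>
  case True
  with h have "h \<in> CF X mtopology"
    unfolding CF_def finitely_determined_def by blast
  with True show ?thesis by blast
next
  case False
  then obtain a where a: "a \<in> topspace (seq_product X)" by blast
  obtain k where k: "\<And>y z. y \<in> topspace (seq_product X) \<Longrightarrow> z \<in> topspace (seq_product X) \<Longrightarrow>
      (\<And>i. i < k \<Longrightarrow> y i = z i) \<Longrightarrow> d (h y) (h z) < \<epsilon>"
    using pseudocompact_uniformly_finitely_determined[OF assms] by blast
  have "splice k a x = splice k a y" if "\<forall>i<k. x i = y i" for x y
    using that by (auto simp: splice_def)
  then have "finitely_determined X (h \<circ> splice k a)"
    unfolding finitely_determined_def o_def by metis
  then have "h \<circ> splice k a \<in> CF X mtopology"
    using continuous_map_compose[OF continuous_map_splice[OF a] h] by (simp add: CF_def)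
  \<comment> \<open>Freezing the tail leaves the coordinates below \<open>k\<close> unchanged, so
    the choice of \<open>k\<close> applies to \<open>splice k a x\<close> and
    \<open>x\<close>.\<close>
  moreover have "d ((h \<circ> splice k a) x) (h x) < \<epsilon>" if "x \<in> topspace (seq_product X)" for x
    using k[OF splice_topspace[OF a that] that] by (simp add: splice_def)
  ultimately show ?thesis by blast
qed

end

theorem theorem13:
  fixes X :: "nat \<Rightarrow> 'a topology"
    and Y :: "'b set" and d :: "'b \<Rightarrow> 'b \<Rightarrow> real"
    and f :: "(nat \<Rightarrow> 'a) \<Rightarrow> 'b"
  assumes "pseudocompact_space (seq_product X)"
    and "Metric_space Y d"
    and "path_connected_space (Metric_space.mtopology Y d)"
    and "separable_space (Metric_space.mtopology Y d)"
    and "R_space Y d"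
    and "baire_one_map (seq_product X) (Metric_space.mtopology Y d) f"
  shows "\<exists>g. (\<forall>n::nat. g n \<in> CF X (Metric_space.mtopology Y d)) \<and>
           (\<forall>x \<in> topspace (seq_product X).
              limitin (Metric_space.mtopology Y d) (\<lambda>n. g n x) (f x) sequentially)"
proof -
  interpret Metric_space Y d by fact
  obtain h where h: "\<And>n::nat. continuous_map (seq_product X) mtopology (h n)"
    and hf: "\<And>x. x \<in> topspace (seq_product X) \<Longrightarrow> limitin mtopology (\<lambda>n. h n x) (f x) sequentially"
    using assms(6) unfolding baire_one_map_def by blast
  have "\<exists>g\<in>CF X mtopology. \<forall>x\<in>topspace (seq_product X). d (g x) (h n x) < inverse (Suc n)" for n
    using pseudocompact_CF_uniform_approx[OF assms(1) h] by simp
  then obtain g where g: "\<And>n. g n \<in> CF X mtopology"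
    and gh: "\<And>n x. x \<in> topspace (seq_product X) \<Longrightarrow> d (g n x) (h n x) < inverse (Suc n)"
    by metis
  have "limitin mtopology (\<lambda>n. g n x) (f x) sequentially"
    if x: "x \<in> topspace (seq_product X)" for x
  proof -
    have maps_Y: "u x \<in> Y" if "continuous_map (seq_product X) mtopology u" for u
      using continuous_map_image_subset_topspace[OF that] x by auto
    have gY: "g n x \<in> Y" and hY: "h n x \<in> Y" for n
      using g[of n] h[of n] by (auto simp: CF_def intro: maps_Y)
    have fY: "f x \<in> Y" and lim: "(\<lambda>n. d (h n x) (f x)) \<longlonglongrightarrow> 0"
      using hf[OF x] by (auto simp: limitin_metric_dist_null)
    \<comment> \<open>The approximation error and the distance of \<open>h n x\<close> from the
      limit both tend to 0; their sum dominates the distance from \<open>g n x\<close> to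
      \<open>f x\<close>.\<close>
    have "(\<lambda>n. inverse (real (Suc n)) + d (h n x) (f x)) \<longlonglongrightarrow> 0"
      using tendsto_add[OF LIMSEQ_inverse_real_of_nat lim] by simp
    moreover have "d (g n x) (f x) \<le> inverse (real (Suc n)) + d (h n x) (f x)" for n
      using triangle[OF gY hY fY] gh[OF x, of n] by (smt (verit))
    ultimately have "(\<lambda>n. d (g n x) (f x)) \<longlonglongrightarrow> 0"
      by (rule_tac tendsto_sandwich[OF _ _ tendsto_const]) auto
    then show ?thesis
      using fY gY by (simp add: limitin_metric_dist_null)
  qed
  with g show ?thesis by blast
qed

end
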